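(* There exist an increasing sequence $(M_n)_{n\ge1}$ of positive integers with $M_n\to\infty$ and a monotone increasing function $\phi:[2,\infty)\to(0,\infty)$ with $\phi(t)\to\infty$ such that, setting $q_1=2$, $q_{n+1}=q_n^{M_n}$, $$G_n=\frac{1}{q_n}\big([0,q_n]\cap\mathbb Z\big),\qquad r_n=q_n^{-\phi(q_n)},\qquad E_n=\{x\in[0,1]:\operatorname{dist}(x,G_n)\le r_n\},\qquad E=\bigcap_{n=1}^\infty E_n,$$ one has $\phi(q_n)<M_n-1$ for every $n$ and $$\dim_P^{\log}(E)\le 1.$$ In particular, $\dim_P^{\log}(E)<2$.
   Context: $\dim_P^{\log}$ denotes logarithmic packing dimension, defined as follows. A gauge function is an increasing right-continuous $\psi:\mathbb R_{\ge0}\to\mathbb R_{\ge0}$ with $\psi(0)=0$ and $\psi(t)>0$ for $t>0$. A $\delta$-packing of a set $F$ is a collection of disjoint balls with centres in $F$ and radii less than $\delta$. The packing pre-measure is $$\mathcal P^\psi_0(F)=\lim_{\delta\to0}\sup\Big\{\sum_i\psi(r_i):\{B(x_i,r_i)\}_i\text{ is a }\delta\text{-packing of }F\Big\},$$ and the outer packing measure is $\mathcal P^\psi(F)=\inf\{\sum_i\mathcal P^\psi_0(F_i):F\subset\bigcup_iF_i\}$, the infimum being over countable covers. For $s>0$ let $h_s$ be a gauge function with $h_s(r)=(\log(1/r))^{-s}$ for sufficiently small $r>0$. Then $\dim_P^{\log}(F)$ is the infimum of all $s>0$ such that $\mathcal P^{h_s}(F)=0$. *)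

theory Defs
  imports "HOL-Analysis.Analysis"
begin

section \<open>Gauge functions and packing measures\<close>

definition gauge_function :: "(real \<Rightarrow> real) \<Rightarrow> bool" where
  "gauge_function \<psi> \<longleftrightarrow>
     mono_on {0..} \<psi> \<and> (\<forall>t\<ge>0. continuous (at_right t) \<psi>) \<and> \<psi> 0 = 0 \<and> (\<forall>t>0. \<psi> t > 0)"

text \<open>
  A packing is encoded as its set of pairs (centre, radius). Balls are closed and have positive
  radius.
\<close>

definition is_packing :: "real \<Rightarrow> 'a::metric_space set \<Rightarrow> ('a \<times> real) set \<Rightarrow> bool" where
  "is_packing \<delta> F P \<longleftrightarrow>
     P \<subseteq> F \<times> {0<..<\<delta>} \<and> disjoint_family_on (\<lambda>(x, r). cball x r) P"

definition packing_sup :: "(real \<Rightarrow> real) \<Rightarrow> 'a::metric_space set \<Rightarrow> real \<Rightarrow> ennreal" where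
  "packing_sup \<psi> F \<delta> = (SUP P\<in>{P. is_packing \<delta> F P}. \<Sum>\<^sub>\<infinity>(x, r)\<in>P. ennreal (\<psi> r))"

definition packing_premeasure :: "(real \<Rightarrow> real) \<Rightarrow> 'a::metric_space set \<Rightarrow> ennreal" where
  "packing_premeasure \<psi> F = Lim (at_right 0) (packing_sup \<psi> F)"

definition packing_measure :: "(real \<Rightarrow> real) \<Rightarrow> 'a::metric_space set \<Rightarrow> ennreal" where
  "packing_measure \<psi> F =
     (INF A\<in>{A :: nat \<Rightarrow> 'a set. F \<subseteq> (\<Union>i. A i)}. \<Sum>i. packing_premeasure \<psi> (A i))"

lemma packing_sup_mono: "\<delta> \<le> \<epsilon> \<Longrightarrow> packing_sup \<psi> F \<delta> \<le> packing_sup \<psi> F \<epsilon>"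
  unfolding packing_sup_def is_packing_def by (rule SUP_subset_mono) fastforce+

text \<open>The limit in the definition of the pre-measure always exists.\<close>

lemma packing_sup_tendsto:
  "(packing_sup \<psi> F \<longlongrightarrow> (INF \<delta>\<in>{0<..}. packing_sup \<psi> F \<delta>)) (at_right 0)"
proof (rule order_tendstoI)
  fix a assume "a < (INF \<delta>\<in>{0<..}. packing_sup \<psi> F \<delta>)"
  then have "a < packing_sup \<psi> F \<delta>" if "\<delta> > 0" for \<delta>
    using that by (meson INF_lower greaterThan_iff less_le_trans)
  then show "\<forall>\<^sub>F \<delta> in at_right 0. a < packing_sup \<psi> F \<delta>"
    unfolding eventually_at_right_field by (intro exI[of _ 1]) auto
next
  fix a assume "(INF \<delta>\<in>{0<..}. packing_sup \<psi> F \<delta>) < a"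
  then obtain \<epsilon> where \<epsilon>: "\<epsilon> > 0" "packing_sup \<psi> F \<epsilon> < a"
    by (auto simp: INF_less_iff)
  then have "packing_sup \<psi> F \<delta> < a" if "\<delta> < \<epsilon>" for \<delta>
    using packing_sup_mono[of \<delta> \<epsilon> \<psi> F] that by simp
  then show "\<forall>\<^sub>F \<delta> in at_right 0. packing_sup \<psi> F \<delta> < a"
    using \<epsilon>(1) eventually_at_right_field by blast
qed

lemma packing_premeasure_eq_INF:
  "packing_premeasure \<psi> F = (INF \<delta>\<in>{0<..}. packing_sup \<psi> F \<delta>)"
  unfolding packing_premeasure_def by (rule tendsto_Lim[OF _ packing_sup_tendsto]) simp

text \<open>The measure depends only on the values of the gauge function near 0.\<close>

lemma packing_sup_cong:
  assumes "\<And>r. 0 < r \<Longrightarrow> r < \<delta> \<Longrightarrow> \<psi> r = \<psi>' r"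
  shows "packing_sup \<psi> F \<delta> = packing_sup \<psi>' F \<delta>"
  unfolding packing_sup_def
  by (rule SUP_cong[OF refl], rule infsum_cong) (use assms in \<open>auto simp: is_packing_def\<close>)

lemma packing_premeasure_cong:
  assumes "\<forall>\<^sub>F r in at_right 0. \<psi> r = \<psi>' r"
  shows "packing_premeasure \<psi> F = packing_premeasure \<psi>' F"
proof -
  obtain b where b: "b > 0" "\<And>r. 0 < r \<Longrightarrow> r < b \<Longrightarrow> \<psi> r = \<psi>' r"
    using assms unfolding eventually_at_right_field by auto
  then have "packing_sup \<psi> F \<delta> = packing_sup \<psi>' F \<delta>" if "\<delta> < b" for \<delta>
    by (intro packing_sup_cong) (use that in auto)
  then have "\<forall>\<^sub>F \<delta> in at_right 0. packing_sup \<psi> F \<delta> = packing_sup \<psi>' F \<delta>"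
    using b(1) eventually_at_right_field by blast
  then have "(packing_sup \<psi> F \<longlongrightarrow> packing_premeasure \<psi>' F) (at_right 0)"
    using packing_sup_tendsto[of \<psi>' F]
    by (simp add: packing_premeasure_eq_INF tendsto_cong)
  then show ?thesis
    unfolding packing_premeasure_def[of \<psi>] by (intro tendsto_Lim) simp_all
qed

lemma packing_measure_cong:
  assumes "\<forall>\<^sub>F r in at_right 0. \<psi> r = \<psi>' r"
  shows "packing_measure \<psi> F = packing_measure \<psi>' F"
  unfolding packing_measure_def by (simp add: packing_premeasure_cong[OF assms])


section \<open>Logarithmic packing dimension\<close>

text \<open>
  One concrete gauge function equal to \<open>(ln (1/r)) powr -s\<close> for small \<open>r > 0\<close>; by
  \<open>packing_measure_cong\<close> the choice away from 0 is irrelevant.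
\<close>

definition log_gauge :: "real \<Rightarrow> real \<Rightarrow> real" where
  "log_gauge s r = (if r \<le> 0 then 0 else if r < exp (-1) then ln (1 / r) powr (- s) else 1)"

lemma log_gauge_eventually: "\<forall>\<^sub>F r in at_right 0. log_gauge s r = ln (1 / r) powr (- s)"
  unfolding eventually_at_right_field log_gauge_def by (intro exI[of _ "exp (-1)"]) auto

lemma gauge_function_log_gauge:
  assumes "s > 0"
  shows "gauge_function (log_gauge s)"
proof -
  have ln_gt: "ln (1 / r) > 1" if "0 < r" "r < exp (-1)" for r :: real
    using that by (simp add: ln_div) (metis exp_gt_zero ln_exp ln_less_cancel_iff minus_less_iff)
  have le1: "log_gauge s r \<le> 1" for r
    using ln_gt[of r] assms by (auto simp: log_gauge_def powr_minus inverse_le_1_iff ge_one_powr_ge_zero)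
  have pos: "log_gauge s r > 0" if "r > 0" for r
    using ln_gt[of r] that by (auto simp: log_gauge_def)
  have mono: "log_gauge s a \<le> log_gauge s b" if "a \<le> b" for a b
  proof (cases "0 < a \<and> b < exp (-1)")
    case True
    then have "ln (1 / b) \<le> ln (1 / a)" "ln (1 / b) > 1"
      using that ln_gt[of b] by (auto simp: frac_le)
    then have "ln (1 / a) powr (- s) \<le> ln (1 / b) powr (- s)"
      using assms by (intro powr_mono2') auto
    then show ?thesis using True that by (simp add: log_gauge_def)
  next
    case False
    then consider "a \<le> 0" | "b \<ge> exp (-1)" by linarith
    then show ?thesis
    proof cases
      case 1
      then show ?thesis using pos[of b] by (cases "b > 0") (auto simp: log_gauge_def)
    next
      case 2
      then have "b > 0" by (meson exp_gt_zero less_le_trans)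
      with 2 have "log_gauge s b = 1" by (simp add: log_gauge_def)
      then show ?thesis using le1 by simp
    qed
  qed
  have cont: "continuous (at_right t) (log_gauge s)" if t: "t \<ge> 0" for t
  proof -
    consider "t = 0" | "0 < t" "t < exp (-1)" | "t \<ge> exp (-1)"
      using t by linarith
    then show ?thesis
    proof cases
      case 1
      have "filterlim (\<lambda>r::real. ln (1 / r)) at_top (at_right 0)"
        by (rule filterlim_compose[OF ln_at_top])
           (use filterlim_inverse_at_top_right in \<open>simp add: inverse_eq_divide\<close>)
      then have "((\<lambda>r. ln (1 / r) powr (- s)) \<longlongrightarrow> 0) (at_right 0)"
        using assms by (intro tendsto_neg_powr) auto
      then have "(log_gauge s \<longlongrightarrow> 0) (at_right 0)"
        by (rule iffD2[OF tendsto_cong[OF log_gauge_eventually]])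
      with 1 show ?thesis by (simp add: continuous_within log_gauge_def)
    next
      case 2
      have "((\<lambda>r. ln (1 / r) powr (- s)) \<longlongrightarrow> ln (1 / t) powr (- s)) (at_right t)"
      proof -
        have "ln (1 / t) > 1" using 2 ln_gt by blast
        then have "ln (1 / t) \<noteq> 0" by linarith
        moreover from 2 have "t \<noteq> 0" "1 / t \<noteq> 0" by simp_all
        ultimately show ?thesis
          by (intro tendsto_powr tendsto_ln tendsto_divide tendsto_const tendsto_ident_at)
      qed
      moreover have ev: "\<forall>\<^sub>F r in at_right t. log_gauge s r = ln (1 / r) powr (- s)"
        unfolding eventually_at_right_field log_gauge_def
        by (intro exI[of _ "exp (-1)"]) (use 2 in auto)
      ultimately have "(log_gauge s \<longlongrightarrow> ln (1 / t) powr (- s)) (at_right t)"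
        by (simp add: tendsto_cong[OF ev])
      with 2 show ?thesis by (simp add: continuous_within log_gauge_def)
    next
      case 3
      have one: "log_gauge s r = 1" if "r \<ge> t" for r
      proof -
        have "r \<ge> exp (-1)" using 3 that by linarith
        moreover have "r > 0" using calculation exp_gt_zero[of "-1::real"] by linarith
        ultimately show ?thesis by (simp add: log_gauge_def)
      qed
      then have "\<forall>\<^sub>F r in at_right t. log_gauge s r = 1"
        unfolding eventually_at_right_field by (intro exI[of _ "t + 1"]) auto
      then have "(log_gauge s \<longlongrightarrow> 1) (at_right t)"
        by (rule tendsto_eventually)
      with one[of t] show ?thesis by (simp add: continuous_within)
    qed
  qed
  show ?thesis
    unfolding gauge_function_def
    by (intro conjI allI impI mono_onI mono pos cont) (simp_all add: log_gauge_def)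
qed

text \<open>Extended-real valued, so that the infimum of the empty set is \<open>\<infinity>\<close>.\<close>

definition log_packing_dim :: "'a::metric_space set \<Rightarrow> ereal" where
  "log_packing_dim F = Inf {ereal s |s. s > 0 \<and> packing_measure (log_gauge s) F = 0}"


section \<open>The sets \<open>E\<close>\<close>

text \<open>Sequences start at index 1; the value at index 0 is a dummy.\<close>

fun q_seq :: "(nat \<Rightarrow> nat) \<Rightarrow> nat \<Rightarrow> nat" where
  "q_seq M 0 = 2"
| "q_seq M (Suc 0) = 2"
| "q_seq M (Suc (Suc n)) = q_seq M (Suc n) ^ M (Suc n)"

definition G_set :: "(nat \<Rightarrow> nat) \<Rightarrow> nat \<Rightarrow> real set" where
  "G_set M n = (\<lambda>x. 1 / real (q_seq M n) * x) ` ({0..real (q_seq M n)} \<inter> \<int>)"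

definition r_seq :: "(nat \<Rightarrow> nat) \<Rightarrow> (real \<Rightarrow> real) \<Rightarrow> nat \<Rightarrow> real" where
  "r_seq M \<phi> n = real (q_seq M n) powr (- \<phi> (real (q_seq M n)))"

definition E_level :: "(nat \<Rightarrow> nat) \<Rightarrow> (real \<Rightarrow> real) \<Rightarrow> nat \<Rightarrow> real set" where
  "E_level M \<phi> n = {x \<in> {0..1}. infdist x (G_set M n) \<le> r_seq M \<phi> n}"

definition E_set :: "(nat \<Rightarrow> nat) \<Rightarrow> (real \<Rightarrow> real) \<Rightarrow> real set" where
  "E_set M \<phi> = (\<Inter>n\<in>{1..}. E_level M \<phi> n)"

end

theory Submission
  imports Defs
begin

text \<open>
  The construction takes \<open>M\<^sub>n = q\<^sub>n\<^sup>5\<close> and \<open>\<phi>(t) = t\<^sup>5 - 2\<close>, so that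
  \<open>r\<^sub>n q\<^sub>n\<^sub>+\<^sub>1 = q\<^sub>n\<^sup>2\<close>. A point of \<open>E\<close> is within \<open>r\<^sub>n\<^sub>+\<^sub>1\<close> of some \<open>j / q\<^sub>n\<^sub>+\<^sub>1\<close> which is itself within
  \<open>2 r\<^sub>n\<close> of \<open>G\<^sub>n\<close>; this leaves at most \<open>(q\<^sub>n + 1) (4 q\<^sub>n\<^sup>2 + 1)\<close> values of \<open>j\<close>, which
  therefore bounds the number of balls of radius at least \<open>r\<^sub>n\<^sub>+\<^sub>1\<close> in a packing of \<open>E\<close>. Those
  of radius below \<open>r\<^sub>n\<close> have gauge at most \<open>1 / ((q\<^sub>n\<^sup>5 - 2) ln q\<^sub>n)\<close>, hence contribute
  \<open>O(q\<^sub>n\<^sup>-\<^sup>2)\<close> in total. Summing over \<open>n\<close>, already the gauge with \<open>s = 1\<close> gives \<open>E\<close>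
  packing measure zero.
\<close>

section \<open>A criterion for vanishing packing measure\<close>

text \<open>If the centres are at most \<open>r + s\<close> apart, the larger of the left centre and
  the left endpoint of the right-hand ball lies in both balls. This uses the order of the line: in a
  general metric space disjoint balls need not have centres so far apart.\<close>

lemma disjoint_cballs_realD:
  fixes x y r s :: real
  assumes "cball x r \<inter> cball y s = {}" "0 \<le> r" "0 \<le> s"
  shows "r + s < \<bar>x - y\<bar>"
proof (rule ccontr)
  assume neg: "\<not> r + s < \<bar>x - y\<bar>"
  have "\<exists>z. z \<in> cball x r \<inter> cball y s"
  proof (cases "x \<le> y")
    case True
    then show ?thesis using neg assms(2,3)
      by (intro exI[of _ "max x (y - s)"]) (auto simp: dist_real_def max_def)
  next
    case False
    then show ?thesis using neg assms(2,3)
      by (intro exI[of _ "max y (x - r)"]) (auto simp: dist_real_def max_def)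
  qed
  with assms(1) show False by blast
qed

text \<open>Sort the balls of a packing by the block \<open>[\<rho> (Suc n), \<rho> n)\<close>
  containing the radius. Block \<open>n\<close> holds at most \<open>N n\<close> balls of gauge at
  most \<open>\<psi> (\<rho> n)\<close>, so a fine packing is dominated by a tail of the convergent
  series.\<close>

lemma packing_measure_eq_0:
  fixes \<psi> :: "real \<Rightarrow> real" and F :: "'a::metric_space set" and N :: "nat \<Rightarrow> nat"
  assumes \<psi>: "gauge_function \<psi>"
    and \<rho>: "decseq \<rho>" "\<And>n. \<rho> n > 0" "\<rho> \<longlonglongrightarrow> 0"
    and card_le: "\<And>n P. finite P \<Longrightarrow> P \<subseteq> F \<times> {\<rho> (Suc n)..} \<Longrightarrow>
      disjoint_family_on (\<lambda>(x, r). cball x r) P \<Longrightarrow> card P \<le> N n"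
    and summable: "summable (\<lambda>n. real (N n) * \<psi> (\<rho> n))"
  shows "packing_measure \<psi> F = 0"
proof -
  have \<psi>_mono: "\<psi> a \<le> \<psi> b" if "0 \<le> a" "a \<le> b" for a b
    using \<psi> that by (auto simp: gauge_function_def mono_on_def)
  have \<psi>_nonneg: "0 \<le> \<psi> a" if "0 \<le> a" for a
    using \<psi> \<psi>_mono[of 0 a] that by (simp add: gauge_function_def)
  define f where "f n = real (N n) * \<psi> (\<rho> n)" for n
  have f_nonneg: "0 \<le> f n" for n
    using \<psi>_nonneg \<rho>(2)[of n] by (simp add: f_def)
  \<comment> \<open>For \<open>0 < r < \<rho> 0\<close> this is the index of the block containing
    \<open>r\<close>.\<close>
  define k where "k r = (LEAST n. \<rho> (Suc n) \<le> r)" for r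
  have sup_le: "\<exists>\<delta>>0. packing_sup \<psi> F \<delta> \<le> ennreal e" if "e > 0" for e
  proof -
    obtain m where m: "\<And>i j. i \<ge> m \<Longrightarrow> norm (sum f {i..<j}) < e"
      using summable \<open>e > 0\<close> unfolding summable_Cauchy f_def by metis
    \<comment> \<open>Radii below \<open>\<rho> m\<close> lie in blocks of index at least
      \<open>m\<close>, which is where the Cauchy bound applies.\<close>
    have "packing_sup \<psi> F (\<rho> m) \<le> ennreal e"
      unfolding packing_sup_def
    proof (intro SUP_least)
      fix P assume "P \<in> {P. is_packing (\<rho> m) F P}"
      then have P: "P \<subseteq> F \<times> {0<..<\<rho> m}" "disjoint_family_on (\<lambda>(x, r). cball x r) P"
        by (auto simp: is_packing_def)
      show "(\<Sum>\<^sub>\<infinity>(x, r)\<in>P. ennreal (\<psi> r)) \<le> ennreal e"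
      proof (rule infsum_le_finite_sums)
        show "(\<lambda>(x, r). ennreal (\<psi> r)) summable_on P"
          by (rule nonneg_summable_on_complete) auto
      next
        \<comment> \<open>The infinite sum is bounded through its finite subsums, to which a bound
          on \<open>card\<close> applies.\<close>
        fix S assume S: "finite S" "S \<subseteq> P"
        have k: "\<rho> (Suc (k r)) \<le> r" "r < \<rho> (k r)" "m \<le> k r" if "(x, r) \<in> S" for x r
        proof -
          have r: "0 < r" "r < \<rho> m" using that S P by auto
          have "\<forall>\<^sub>F n in sequentially. \<rho> n < r"
            using \<rho>(3) r(1) by (rule order_tendstoD)
          then obtain n where "\<rho> (Suc n) \<le> r"
            by (metis eventually_sequentially le_SucI less_imp_le order_refl)
          then show 1: "\<rho> (Suc (k r)) \<le> r" unfolding k_def by (rule LeastI)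
          show "r < \<rho> (k r)"
          proof (cases "k r")
            \<comment> \<open>Minimality of \<open>k r\<close> says nothing here; the upper bound
              comes from \<open>r < \<rho> m \<le> \<rho> 0\<close>.\<close>
            case 0
            with r \<rho>(1) show ?thesis
              by (metis decseqD le0 order_less_le_trans)
          next
            case (Suc j)
            then have "\<not> \<rho> (Suc j) \<le> r"
              using not_less_Least[of j "\<lambda>n. \<rho> (Suc n) \<le> r"] by (simp add: k_def)
            with Suc show ?thesis by simp
          qed
          show "m \<le> k r"
          proof (rule ccontr)
            assume "\<not> m \<le> k r"
            then have "\<rho> m \<le> \<rho> (Suc (k r))" using \<rho>(1) by (simp add: decseqD)
            with 1 r show False by simp
          qed
        qed
        let ?K = "(k \<circ> snd) ` S"
        obtain j where j: "?K \<subseteq> {..<j}"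
          using finite_nat_bounded[of ?K] S by auto
        have "(\<Sum>p\<in>S. \<psi> (snd p)) = (\<Sum>n\<in>?K. \<Sum>p\<in>{p\<in>S. (k \<circ> snd) p = n}. \<psi> (snd p))"
          by (rule sum.image_gen) fact
        also have "\<dots> \<le> (\<Sum>n\<in>?K. f n)"
        proof (rule sum_mono)
          fix n
          let ?S = "{p \<in> S. (k \<circ> snd) p = n}"
          have "(\<Sum>p\<in>?S. \<psi> (snd p)) \<le> (\<Sum>p\<in>?S. \<psi> (\<rho> n))"
          proof (rule sum_mono)
            fix p assume "p \<in> ?S"
            then have "(fst p, snd p) \<in> S" "k (snd p) = n" by auto
            with k(2)[of "fst p" "snd p"] show "\<psi> (snd p) \<le> \<psi> (\<rho> n)"
              using S P by (intro \<psi>_mono) auto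
          qed
          also have "\<dots> = real (card ?S) * \<psi> (\<rho> n)" by simp
          also have "\<dots> \<le> f n"
            unfolding f_def
          proof (intro mult_right_mono \<psi>_nonneg)
            have "card ?S \<le> N n"
            proof (rule card_le)
              show "?S \<subseteq> F \<times> {\<rho> (Suc n)..}"
                using S P k(1) by auto
              show "disjoint_family_on (\<lambda>(x, r). cball x r) ?S"
                by (rule disjoint_family_on_mono[OF _ P(2)]) (use S in auto)
            qed (use S in simp)
            then show "real (card ?S) \<le> real (N n)" by simp
          qed (use \<rho>(2)[of n] in simp)
          finally show "(\<Sum>p\<in>?S. \<psi> (snd p)) \<le> f n" .
        qed
        also have "\<dots> \<le> sum f {m..<j}"
          using j k(3) f_nonneg by (intro sum_mono2) auto
        also have "\<dots> \<le> e" using m[of m j] by simp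
        finally have "ennreal (\<Sum>p\<in>S. \<psi> (snd p)) \<le> ennreal e" by (rule ennreal_leI)
        moreover have "(\<Sum>(x, r)\<in>S. ennreal (\<psi> r)) = ennreal (\<Sum>p\<in>S. \<psi> (snd p))"
          using S P by (subst sum_ennreal[symmetric]) (auto simp: case_prod_unfold intro!: \<psi>_nonneg)
        ultimately show "(\<Sum>(x, r)\<in>S. ennreal (\<psi> r)) \<le> ennreal e" by simp
      qed
    qed
    with \<rho>(2) show ?thesis by blast
  qed
  have "packing_premeasure \<psi> F \<le> 0"
  proof (rule ennreal_le_epsilon)
    fix e :: real assume "e > 0"
    then obtain \<delta> where \<delta>: "\<delta> > 0" "packing_sup \<psi> F \<delta> \<le> ennreal e" using sup_le by blast
    then have "packing_premeasure \<psi> F \<le> packing_sup \<psi> F \<delta>"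
      unfolding packing_premeasure_eq_INF by (intro INF_lower) simp
    with \<delta>(2) show "packing_premeasure \<psi> F \<le> 0 + ennreal e" by simp
  qed
  then have "packing_premeasure \<psi> F = 0" by simp
  \<comment> \<open>The constant cover by \<open>F\<close> suffices: its total is a countable sum of
    zeros.\<close>
  moreover have "packing_measure \<psi> F \<le> (\<Sum>i. packing_premeasure \<psi> ((\<lambda>_::nat. F) i))"
    unfolding packing_measure_def by (rule INF_lower) auto
  ultimately show ?thesis by simp
qed

section \<open>Denominators, exponents and radii\<close>

text \<open>Denominators are indexed from 0 here: \<open>tower n\<close> is the paper's \<open>q\<^sub>n\<^sub>+\<^sub>1\<close>.\<close>

fun tower :: "nat \<Rightarrow> nat" where
  "tower 0 = 2"
| "tower (Suc n) = tower n ^ (tower n ^ 5)"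

text \<open>The shift returns to the indexing of \<open>q_seq\<close> from 1; truncated subtraction
  supplies the dummy value at 0. The fifth power is chosen to beat the cubic count in
  \<open>card_packing_E_set_le\<close>.\<close>

definition tower_exponent :: "nat \<Rightarrow> nat" where
  "tower_exponent n = tower (n - 1) ^ 5"

definition approx_order :: "real \<Rightarrow> real" where
  "approx_order t = t ^ 5 - 2"

definition radius :: "nat \<Rightarrow> real" where
  "radius n = real (tower n) powr - approx_order (real (tower n))"

lemma q_seq_tower: "q_seq tower_exponent (Suc n) = tower n"
  by (induction n) (simp_all add: tower_exponent_def)

lemma r_seq_radius: "r_seq tower_exponent approx_order (Suc n) = radius n"
  by (simp add: r_seq_def radius_def q_seq_tower)

text \<open>Far from sharp, but enough to compare \<open>1 / tower n ^ 2\<close> with a geometric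
  series and to send the exponents to infinity.\<close>

lemma tower_ge: "2 ^ Suc n \<le> tower n"
proof (induction n)
  case (Suc n)
  have "2 \<le> tower n" using Suc by (rule order_trans[rotated]) simp
  then have "2 \<le> tower n ^ 5" using self_le_power[of "tower n" 5] by linarith
  have "2 ^ Suc (Suc n) = 2 * 2 ^ Suc n" by simp
  also have "\<dots> \<le> tower n * tower n" using \<open>2 \<le> tower n\<close> Suc by (rule mult_le_mono)
  also have "\<dots> = tower n ^ 2" by (simp add: power2_eq_square)
  also have "\<dots> \<le> tower n ^ (tower n ^ 5)"
    using \<open>2 \<le> tower n\<close> \<open>2 \<le> tower n ^ 5\<close> by (intro power_increasing) auto
  finally show ?case by simp
qed simp

lemma tower_ge_2: "2 \<le> tower n"
  using tower_ge[of n] by (rule order_trans[rotated]) simp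

lemma tower_mono: "m \<le> n \<Longrightarrow> tower m \<le> tower n"
proof (rule lift_Suc_mono_le[of tower])
  show "tower n \<le> tower (Suc n)" for n
    using tower_ge_2[of n] by (simp add: self_le_power)
qed

lemma tower_dvd_Suc: "tower n dvd tower (Suc n)"
  using tower_ge_2[of n] by (simp add: dvd_power)

lemma power5_ge: "32 \<le> t ^ 5" if "2 \<le> t" for t :: real
  using power_mono[OF that, of 5] by simp

lemma radius_pos: "0 < radius n"
  using tower_ge_2[of n] by (simp add: radius_def)

text \<open>The exponents \<open>2 - q ^ 5\<close> and \<open>q ^ 5\<close> of
  \<open>q = tower n\<close> add up to 2. Hence an interval of half-length \<open>radius n\<close>
  meets the next grid in a number of points only quadratic in \<open>q\<close>.\<close>

lemma radius_mult_tower_Suc: "radius n * real (tower (Suc n)) = real (tower n) ^ 2"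
proof -
  have q: "0 < real (tower n)" using tower_ge_2[of n] by simp
  have "radius n * real (tower (Suc n)) =
      real (tower n) powr (2 - real (tower n ^ 5)) * real (tower n) powr real (tower n ^ 5)"
    using powr_realpow[OF q, of "tower n ^ 5"] by (simp add: radius_def approx_order_def)
  also have "\<dots> = real (tower n) powr 2" by (simp add: powr_add[symmetric])
  finally show ?thesis using q by simp
qed

lemma radius_le: "radius n \<le> 1 / real (tower n) ^ 2"
proof -
  have q: "2 \<le> real (tower n)" using tower_ge_2[of n] by simp
  have "radius n \<le> real (tower n) powr (- 2)"
    unfolding radius_def approx_order_def using q power5_ge[OF q] by (intro powr_mono) auto
  also have "\<dots> = 1 / real (tower n) ^ 2"
    using q by (simp add: powr_minus divide_inverse)
  finally show ?thesis .
qed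

lemma radius_decseq: "decseq radius"
proof (rule decseq_SucI)
  fix n
  have q: "2 \<le> real (tower n)" "2 \<le> real (tower (Suc n))"
    using tower_ge_2[of n] tower_ge_2[of "Suc n"] by (simp_all del: tower.simps)
  have "radius (Suc n) \<le> 1 / real (tower (Suc n)) ^ 2" by (rule radius_le)
  also have "\<dots> \<le> real (tower n) ^ 2 / real (tower (Suc n))"
    using q by (intro frac_le one_le_power self_le_power) (auto simp del: tower.simps)
  also have "\<dots> = radius n"
    using q by (simp add: radius_mult_tower_Suc[symmetric] del: tower.simps)
  finally show "radius (Suc n) \<le> radius n" .
qed

lemma inverse_tower_square_le: "1 / real (tower n) ^ 2 \<le> (1 / 4) ^ n"
proof -
  have "(2::real) ^ n \<le> real (tower n)"
    using tower_ge[of n] of_nat_mono[of "2 ^ Suc n" "tower n", where 'a=real] by simp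
  then have "(2 ^ n) ^ 2 \<le> real (tower n) ^ 2" by (rule power_mono) simp
  moreover have "((2::real) ^ n) ^ 2 = 4 ^ n" by (simp add: power_mult[symmetric] mult.commute[of n] power_mult)
  ultimately show ?thesis by (simp add: power_one_over frac_le)
qed

lemma radius_tendsto_0: "radius \<longlonglongrightarrow> 0"
proof (rule tendsto_sandwich[of "\<lambda>_. 0"])
  show "\<forall>\<^sub>F n in sequentially. radius n \<le> (1 / 4) ^ n"
    by (intro always_eventually allI order_trans[OF radius_le inverse_tower_square_le])
  show "(\<lambda>n. (1 / 4 :: real) ^ n) \<longlonglongrightarrow> 0" by (rule LIMSEQ_power_zero) simp
qed (auto intro!: always_eventually less_imp_le[OF radius_pos])

lemma log_gauge_radius_le: "log_gauge 1 (radius n) \<le> 4 / real (tower n) ^ 5"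
proof -
  have q: "2 \<le> real (tower n)" using tower_ge_2[of n] by simp
  have "4 \<le> real (tower n) ^ 2" using power_mono[OF q, of 2] by simp
  then have "1 / real (tower n) ^ 2 \<le> 1 / 4" using q by (intro divide_left_mono) auto
  with radius_le have "radius n \<le> 1 / 4" by (rule order_trans)
  \<comment> \<open>Since e is at most 3, the radius falls in the logarithmic branch of
    \<open>log_gauge\<close>.\<close>
  moreover have "1 / 4 < exp (- 1 :: real)"
    using exp_le by (simp add: exp_minus divide_simps)
  ultimately have "log_gauge 1 (radius n) = ln (1 / radius n) powr - 1"
    using radius_pos[of n] by (simp add: log_gauge_def)
  also have "\<dots> = 1 / ln (1 / radius n)"
    using radius_pos[of n] \<open>radius n \<le> 1 / 4\<close>
    by (subst powr_minus_divide, subst powr_one) (simp_all add: ln_ge_zero)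
  also have "ln (1 / radius n) = (real (tower n) ^ 5 - 2) * ln (real (tower n))"
    using q by (simp add: radius_def approx_order_def ln_div ln_powr algebra_simps)
  also have "1 / \<dots> \<le> 1 / (real (tower n) ^ 5 / 2 * (1 / 2))"
  proof (intro divide_left_mono mult_mono mult_pos_pos)
    \<comment> \<open>From \<open>ln (1 / 2) \<le> 1 / 2 - 1\<close>. The other factor uses
      \<open>q ^ 5 - 2 \<ge> q ^ 5 / 2\<close>.\<close>
    have "1 / 2 \<le> ln (2 :: real)" using ln_le_minus_one[of "1 / 2"] by (simp add: ln_div)
    also have "\<dots> \<le> ln (real (tower n))" using q by simp
    finally show "1 / 2 \<le> ln (real (tower n))" .
  qed (use q power5_ge[OF q] in auto)
  finally show ?thesis by simp
qed

section \<open>Counting the large balls in a packing of \<open>E\<close>\<close>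

text \<open>The grid is finite and nonempty, so \<open>infdist\<close> is attained at a grid
  point.\<close>

lemma E_level_approx:
  assumes "x \<in> E_level M \<phi> n"
  obtains i :: int where "0 \<le> i" "i \<le> int (q_seq M n)" "\<bar>x - i / q_seq M n\<bar> \<le> r_seq M \<phi> n"
proof -
  have "{0..real (q_seq M n)} \<inter> \<int> \<subseteq> real_of_int ` {0..int (q_seq M n)}"
    by (auto elim!: Ints_cases)
  then have "finite (G_set M n)"
    unfolding G_set_def by (intro finite_imageI) (rule finite_subset, auto)
  moreover have "0 \<in> G_set M n" unfolding G_set_def by (rule image_eqI[of _ _ 0]) auto
  ultimately obtain g where g: "g \<in> G_set M n" "infdist x (G_set M n) = dist x g"
    using infdist_attains_inf[of "G_set M n" x] finite_imp_closed by blast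
  then obtain z where "z \<in> {0..real (q_seq M n)} \<inter> \<int>" "g = 1 / real (q_seq M n) * z"
    unfolding G_set_def by blast
  then obtain i where "0 \<le> i" "i \<le> int (q_seq M n)" "g = i / q_seq M n"
    by (auto elim!: Ints_cases)
  with g(2) assms show ?thesis
    by (intro that[of i]) (auto simp: E_level_def dist_real_def)
qed

text \<open>Levels \<open>n\<close> and \<open>n + 1\<close> are combined. With \<open>q\<close>,
  \<open>Q\<close>, \<open>K\<close> as in the proof, the grids are nested and
  \<open>i / q = i * K / Q\<close>, so the fine numerator is \<open>j = i * K + d\<close>. The
  triangle inequality gives \<open>\<bar>j / Q - i / q\<bar> \<le> 2 * radius n\<close>; multiplying
  by \<open>Q\<close> gives \<open>\<bar>d\<bar> \<le> 2 * q ^ 2\<close>.\<close>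

lemma E_set_approx:
  assumes "x \<in> E_set tower_exponent approx_order"
  obtains i d :: int where "i \<in> {0..int (tower n)}" "d \<in> {- 2 * int (tower n) ^ 2..2 * int (tower n) ^ 2}"
    "\<bar>x - real_of_int (i * int (tower (Suc n) div tower n) + d) / tower (Suc n)\<bar> \<le> radius (Suc n)"
proof -
  define q Q K where "q = tower n" and "Q = tower (Suc n)" and "K = tower (Suc n) div tower n"
  have Q: "Q = K * q" using tower_dvd_Suc[of n] by (simp add: Q_def K_def q_def del: tower.simps)
  have pos: "0 < q" "0 < Q"
    using tower_ge_2[of n] tower_ge_2[of "Suc n"] by (simp_all add: q_def Q_def del: tower.simps)
  have x: "x \<in> E_level tower_exponent approx_order (Suc k)" for k
    using assms by (auto simp: E_set_def)
  obtain i :: int where i: "0 \<le> i" "i \<le> int q" "\<bar>x - i / q\<bar> \<le> radius n"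
    using E_level_approx[OF x[of n]] unfolding q_seq_tower r_seq_radius q_def by blast
  obtain j :: int where j: "\<bar>x - j / Q\<bar> \<le> radius (Suc n)"
    using E_level_approx[OF x[of "Suc n"]] unfolding q_seq_tower r_seq_radius Q_def by blast
  have "radius (Suc n) \<le> radius n" using radius_decseq by (simp add: decseq_Suc_iff)
  with i(3) j have "\<bar>j / Q - i / q\<bar> \<le> 2 * radius n" by linarith
  then have "\<bar>j / Q - i / q\<bar> * Q \<le> 2 * radius n * Q" by (rule mult_right_mono) simp
  also have "\<dots> = real_of_int (2 * int q ^ 2)"
    using radius_mult_tower_Suc[of n] by (simp add: Q_def q_def del: tower.simps)
  also have "\<bar>j / Q - i / q\<bar> * Q = \<bar>(j / Q - i / q) * Q\<bar>" by (simp add: abs_mult)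
  also have "(j / Q - i / q) * Q = real_of_int (j - i * int K)"
    using pos by (simp add: Q field_simps)
  finally have d: "\<bar>j - i * int K\<bar> \<le> 2 * int q ^ 2" by (simp only: of_int_abs[symmetric] of_int_le_iff)
  show ?thesis
  proof (rule that)
    show "i \<in> {0..int (tower n)}" using i by (simp add: q_def)
    show "j - i * int K \<in> {- 2 * int (tower n) ^ 2..2 * int (tower n) ^ 2}"
      using d by (auto simp: q_def abs_le_iff)
    show "\<bar>x - real_of_int (i * int (tower (Suc n) div tower n) + (j - i * int K)) / tower (Suc n)\<bar> \<le> radius (Suc n)"
      using j unfolding K_def Q_def by (simp del: tower.simps)
  qed
qed

text \<open>Code each ball by a pair \<open>(i, d)\<close> whose grid point is near its centre.
  Balls with the same code have centres at most \<open>2 * radius (Suc n)\<close> apart, whereas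
  disjointness puts the centres further apart than the sum of the radii, which is at least that
  much. So the coding is injective.\<close>

lemma card_packing_E_set_le:
  assumes "P \<subseteq> E_set tower_exponent approx_order \<times> {radius (Suc n)..}"
    and disj: "disjoint_family_on (\<lambda>(x, r). cball x r) P"
  shows "card P \<le> (tower n + 1) * (4 * tower n ^ 2 + 1)"
proof -
  define near where "near x = (\<lambda>(i, d).
    \<bar>x - real_of_int (i * int (tower (Suc n) div tower n) + d) / tower (Suc n)\<bar> \<le> radius (Suc n))" for x
  let ?B = "{0..int (tower n)} \<times> {- 2 * int (tower n) ^ 2..2 * int (tower n) ^ 2}"
  have "\<exists>b\<in>?B. near (fst p) b" if "p \<in> P" for p
  proof -
    from that assms(1) have "fst p \<in> E_set tower_exponent approx_order" by auto
    from E_set_approx[OF this, of n] show ?thesis unfolding near_def by fastforce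
  qed
  then obtain b where b: "\<And>p. p \<in> P \<Longrightarrow> b p \<in> ?B" "\<And>p. p \<in> P \<Longrightarrow> near (fst p) (b p)"
    by metis
  have "inj_on b P"
  proof (rule inj_onI, rule ccontr)
    fix p p' assume p: "p \<in> P" "p' \<in> P" "b p = b p'" "p \<noteq> p'"
    have r: "radius (Suc n) \<le> snd p" "radius (Suc n) \<le> snd p'" using p assms(1) by auto
    have "cball (fst p) (snd p) \<inter> cball (fst p') (snd p') = {}"
      using disjoint_family_onD[OF disj p(1,2,4)] by (simp add: case_prod_unfold)
    then have "snd p + snd p' < \<bar>fst p - fst p'\<bar>"
      using r radius_pos[of "Suc n"] by (intro disjoint_cballs_realD) auto
    moreover have "near (fst p) (b p)" "near (fst p') (b p)" using b(2) p by metis+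
    then have "\<bar>fst p - fst p'\<bar> \<le> 2 * radius (Suc n)"
      unfolding near_def case_prod_unfold by linarith
    ultimately show False using r by linarith
  qed
  moreover have "b ` P \<subseteq> ?B" using b(1) by blast
  ultimately have "card P \<le> card ?B" by (rule card_inj_on_le) simp
  also have "\<dots> = (tower n + 1) * (4 * tower n ^ 2 + 1)"
    by (simp add: card_cartesian_product nat_add_distrib nat_mult_distrib nat_power_eq flip: of_nat_power)
  finally show ?thesis .
qed

section \<open>Packing measure zero at \<open>s = 1\<close>, and the dimension bound\<close>

lemma packing_measure_E_set: "packing_measure (log_gauge 1) (E_set tower_exponent approx_order) = 0"
proof (rule packing_measure_eq_0)
  show "gauge_function (log_gauge 1)" by (rule gauge_function_log_gauge) simp
  show "card P \<le> (tower n + 1) * (4 * tower n ^ 2 + 1)"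
    if "P \<subseteq> E_set tower_exponent approx_order \<times> {radius (Suc n)..}"
      "disjoint_family_on (\<lambda>(x, r). cball x r) P" for n P
    using that by (rule card_packing_E_set_le)
  \<comment> \<open>With \<open>q = tower n\<close>, the count is at most \<open>10 * q ^ 3\<close>
    and the gauge at most \<open>4 / q ^ 5\<close>, so the terms are at most
    \<open>40 / q ^ 2\<close>.\<close>
  show "summable (\<lambda>n. real ((tower n + 1) * (4 * tower n ^ 2 + 1)) * log_gauge 1 (radius n))"
  proof (rule summable_comparison_test', rule summable_mult, rule summable_geometric)
    fix n
    define q where "q = real (tower n)"
    have q: "2 \<le> q" using tower_ge_2[of n] by (simp add: q_def)
    have nonneg: "0 \<le> log_gauge 1 (radius n)" by (simp add: log_gauge_def)
    have "real ((tower n + 1) * (4 * tower n ^ 2 + 1)) = (q + 1) * (4 * q ^ 2 + 1)"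
      by (simp add: q_def algebra_simps)
    also have "\<dots> \<le> (2 * q) * (5 * q ^ 2)"
      using q one_le_power[of q 2] by (intro mult_mono) auto
    finally have "real ((tower n + 1) * (4 * tower n ^ 2 + 1)) * log_gauge 1 (radius n)
        \<le> (2 * q) * (5 * q ^ 2) * (4 / q ^ 5)"
      using log_gauge_radius_le[of n] nonneg q by (intro mult_mono) (auto simp: q_def)
    also have "\<dots> = 40 * (1 / q ^ 2)"
      using q by (simp add: field_simps eval_nat_numeral)
    also have "\<dots> \<le> 40 * (1 / 4) ^ n"
      using inverse_tower_square_le[of n] unfolding q_def by (rule mult_left_mono) simp
    finally show "norm (real ((tower n + 1) * (4 * tower n ^ 2 + 1)) * log_gauge 1 (radius n))
        \<le> 40 * (1 / 4) ^ n"
      using nonneg by simp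
  qed simp
qed (rule radius_decseq radius_pos radius_tendsto_0)+

theorem corollary2p12:
  "\<exists>(M :: nat \<Rightarrow> nat) (\<phi> :: real \<Rightarrow> real).
     (\<forall>n\<ge>1. M n > 0) \<and> mono_on {1..} M \<and> filterlim M at_top sequentially \<and>
     (\<forall>t\<ge>2. \<phi> t > 0) \<and> mono_on {2..} \<phi> \<and> filterlim \<phi> at_top at_top \<and>
     (\<forall>n\<ge>1. \<phi> (real (q_seq M n)) < real (M n) - 1) \<and>
     log_packing_dim (E_set M \<phi>) \<le> 1 \<and>
     log_packing_dim (E_set M \<phi>) < 2"
proof (intro exI[of _ tower_exponent] exI[of _ approx_order] conjI allI impI)
  show "tower_exponent n > 0" for n
    using tower_ge_2[of "n - 1"] by (simp add: tower_exponent_def)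
  show "mono_on {1..} tower_exponent"
    by (intro mono_onI) (simp add: tower_exponent_def power_mono tower_mono)
  show "filterlim tower_exponent at_top sequentially"
  proof (rule filterlim_at_top_mono[OF filterlim_ident])
    have "n \<le> tower_exponent n" for n
    proof -
      have "n < 2 ^ n" by (rule less_exp)
      also have "\<dots> \<le> 2 ^ Suc (n - 1)" by (intro power_increasing) auto
      also have "\<dots> \<le> tower (n - 1)" by (rule tower_ge)
      also have "\<dots> \<le> tower (n - 1) ^ 5" using tower_ge_2[of "n - 1"] by (intro self_le_power) auto
      finally show ?thesis by (simp add: tower_exponent_def)
    qed
    then show "\<forall>\<^sub>F n in sequentially. n \<le> tower_exponent n" by simp
  qed
  show "approx_order t > 0" if "2 \<le> t" for t
    using power5_ge[OF that] by (simp add: approx_order_def)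
  show "mono_on {2..} approx_order"
    by (intro mono_onI) (auto simp: approx_order_def intro!: power_mono)
  have "filterlim (\<lambda>t::real. - 2 + t ^ 5) at_top at_top"
    by (intro filterlim_tendsto_add_at_top[OF tendsto_const] filterlim_pow_at_top filterlim_ident) simp
  then show "filterlim approx_order at_top at_top"
    by (simp add: approx_order_def[abs_def])
  \<comment> \<open>With \<open>q = tower (n - 1)\<close> this reads
    \<open>q ^ 5 - 2 < q ^ 5 - 1\<close>.\<close>
  show "approx_order (real (q_seq tower_exponent n)) < real (tower_exponent n) - 1" if "1 \<le> n" for n
    using that q_seq_tower[of "n - 1"] by (simp add: approx_order_def tower_exponent_def)
  have "(1::ereal) \<in> {ereal s |s. s > 0 \<and>
      packing_measure (log_gauge s) (E_set tower_exponent approx_order) = 0}"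
    using packing_measure_E_set by (auto intro!: exI[of _ 1] simp: one_ereal_def)
  then show le: "log_packing_dim (E_set tower_exponent approx_order) \<le> 1"
    unfolding log_packing_dim_def by (rule Inf_lower)
  also have "(1::ereal) < 2" by simp
  finally show "log_packing_dim (E_set tower_exponent approx_order) < 2" .
qed

end
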